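(* For an $n$-vertex tree $T$ ($n\ge 1$) and an integer $\ell\ge 0$, let $S_\ell^{(T)}$ be the set of self-reachable configurations on $T$ with exactly $\ell$ chips. Then $|S_\ell^{(T)}|$ depends only on $\ell$ and $n$, and writing $C_{\ell,n}:=|S_\ell^{(T)}|$ for any $n$-vertex tree $T$, the numbers $C_{\ell,n}$ satisfy, for all integers $\ell\ge 2$ and $n\ge 2$, $$C_{\ell,n}=C_{\ell-1,n}+2C_{\ell-1,n-1}-C_{\ell-2,n-1},$$ with $C_{\ell,1}=1$ for all $\ell\ge 0$, $C_{0,n}=0$ for all $n\ge 2$, $C_{1,2}=2$, and $C_{1,n}=0$ for all $n\ge 3$.
   Context: All graphs are finite and simple with at least one vertex; the vertices of an $n$-vertex graph are labelled $v_1,\dots,v_n$. A chip configuration on an $n$-vertex graph $G$ is a vector $\mathbf{c}\in\mathbb{Z}_{\ge 0}^n$, where $c_i$ is the number of chips on $v_i$; its number of chips is $\sum_i c_i$. The Laplacian $\Delta(G)$ is the $n\times n$ matrix with $\Delta_{ii}=\deg(v_i)$, $\Delta_{ij}=-1$ if $i\ne j$ and $v_i,v_j$ are adjacent, and $\Delta_{ij}=0$ otherwise. Firing $v_i$ from $\mathbf{c}$ yields $\mathbf{c}-\Delta(G)\mathbf{e}_i$ (with $\mathbf{e}_i$ the $i$th standard basis vector); this is legal if $c_i\ge\deg(v_i)$, equivalently if the result is again a chip configuration (so firing a vertex of degree $0$ is always legal and changes nothing). A firing sequence is a finite sequence of vertex indices; it is legal on $G$ starting from $\mathbf{c}$ if,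 performing the firings in order starting from $\mathbf{c}$, each one is legal from the configuration reached so far. $R^{(G)}(\mathbf{c})$ denotes the set of chip configurations that can be reached from $\mathbf{c}$ by nonempty legal firing sequences on $G$. A chip configuration $\mathbf{s}$ on a connected graph $G$ is self-reachable on $G$ if $\mathbf{s}\in R^{(G)}(\mathbf{s})$. *)

theory Defs
  imports "Jordan_Normal_Form.Matrix" "Graph_Theory.Graph_Theory"
begin

text \<open>
  Simple graphs are symmetric loop-free digraphs without parallel arcs (\<^locale>\<open>pair_graph\<close>), so
  every undirected edge is present as two opposite arcs and the degree of a vertex is its
  out-degree. The vertices are labelled \<open>0, \<dots>, n - 1\<close>, matching the indices of vectors and matrices.
\<close>

definition labelled_graph :: "nat \<Rightarrow> nat pair_pre_digraph \<Rightarrow> bool" where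
  "labelled_graph n G \<longleftrightarrow> n \<ge> 1 \<and> pair_graph G \<and> pverts G = {..<n}"

text \<open>
  The library predicates \<^const>\<open>forest\<close> and \<^const>\<open>tree\<close> are of no use for undirected graphs: in a
  symmetric digraph the walk along an edge and back is a \<^const>\<open>pre_digraph.cycle\<close>. The
  cycles of the undirected graph are those of length at least 3.
\<close>

definition labelled_tree :: "nat \<Rightarrow> nat pair_pre_digraph \<Rightarrow> bool" where
  "labelled_tree n T \<longleftrightarrow> labelled_graph n T \<and> Digraph_Component.connected (with_proj T) \<and>
     \<not> (\<exists>p. pre_digraph.cycle (with_proj T) p \<and> length p \<ge> 3)"

abbreviation deg :: "nat pair_pre_digraph \<Rightarrow> nat \<Rightarrow> nat" where
  "deg G i \<equiv> out_degree (with_proj G) i"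

abbreviation nverts :: "nat pair_pre_digraph \<Rightarrow> nat" where
  "nverts G \<equiv> card (pverts G)"

definition laplacian :: "nat pair_pre_digraph \<Rightarrow> int mat" where
  "laplacian G = mat (nverts G) (nverts G)
     (\<lambda>(i, j). if i = j then int (deg G i) else if (i, j) \<in> parcs G then -1 else 0)"

definition chip_configs :: "nat pair_pre_digraph \<Rightarrow> int vec set" where
  "chip_configs G = {c \<in> carrier_vec (nverts G). \<forall>i < nverts G. 0 \<le> c $ i}"

definition num_chips :: "int vec \<Rightarrow> int" where
  "num_chips c = (\<Sum>i < dim_vec c. c $ i)"

definition fire :: "nat pair_pre_digraph \<Rightarrow> nat \<Rightarrow> int vec \<Rightarrow> int vec" where
  "fire G i c = c - laplacian G *\<^sub>v unit_vec (nverts G) i"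

fun legal_firing_seq :: "nat pair_pre_digraph \<Rightarrow> int vec \<Rightarrow> nat list \<Rightarrow> bool" where
  "legal_firing_seq G c [] \<longleftrightarrow> True"
| "legal_firing_seq G c (i # is) \<longleftrightarrow>
     i \<in> pverts G \<and> int (deg G i) \<le> c $ i \<and> legal_firing_seq G (fire G i c) is"

definition reachable_configs :: "nat pair_pre_digraph \<Rightarrow> int vec \<Rightarrow> int vec set" where
  "reachable_configs G c = {c' \<in> chip_configs G.
     \<exists>is. is \<noteq> [] \<and> legal_firing_seq G c is \<and> c' = fold (fire G) is c}"

definition self_reachable :: "nat pair_pre_digraph \<Rightarrow> int vec \<Rightarrow> bool" where
  "self_reachable G s \<longleftrightarrow> s \<in> chip_configs G \<and> s \<in> reachable_configs G s"

definition self_reachable_configs :: "nat pair_pre_digraph \<Rightarrow> nat \<Rightarrow> int vec set" where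
  "self_reachable_configs G l = {s. self_reachable G s \<and> num_chips s = int l}"

text \<open>Hence \<^const>\<open>card\<close> gives the true number of these configurations.\<close>

lemma finite_self_reachable_configs: "finite (self_reachable_configs G l)"
proof -
  let ?n = "nverts G"
  have "self_reachable_configs G l \<subseteq> vec_of_list ` {xs. set xs \<subseteq> {0..int l} \<and> length xs = ?n}"
  proof
    fix s assume "s \<in> self_reachable_configs G l"
    then have d: "dim_vec s = ?n" and nn: "\<And>i. i < ?n \<Longrightarrow> 0 \<le> s $ i"
      and sm: "(\<Sum>i < ?n. s $ i) = int l"
      by (auto simp: self_reachable_configs_def self_reachable_def chip_configs_def num_chips_def)
    have "s $ i \<le> int l" if "i < ?n" for i
      using member_le_sum[of i "{..<?n}" "\<lambda>i. s $ i"] nn sm that by auto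
    then have "set (list_of_vec s) \<subseteq> {0..int l}"
      using nn d by (auto simp: in_set_conv_nth list_of_vec_index)
    then show "s \<in> vec_of_list ` {xs. set xs \<subseteq> {0..int l} \<and> length xs = ?n}"
      using d by (intro image_eqI[of _ _ "list_of_vec s"]) (auto simp: vec_list)
  qed
  then show ?thesis
    by (rule finite_subset) (simp add: finite_lists_length_eq)
qed

text \<open>Trees of every order exist, so a number given by all of them is determined.\<close>

lemma labelled_tree_exists:
  assumes "n \<ge> 1"
  shows "\<exists>T. labelled_tree n T"
proof -
  define T :: "nat pair_pre_digraph" where
    "T = \<lparr> pverts = {..<n}, parcs = {0} \<times> {1..<n} \<union> {1..<n} \<times> {0} \<rparr>"
  have pg: "pair_graph T"
    using assms by unfold_locales (auto simp: T_def symmetric_def sym_def)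
  interpret pair_graph T by (rule pg)
  have V: "pverts T = {..<n}" by (simp add: T_def)
  have to0: "u \<rightarrow>\<^sup>*\<^bsub>with_proj T\<^esub> 0" and from0: "0 \<rightarrow>\<^sup>*\<^bsub>with_proj T\<^esub> u" if "u < n" for u
  proof -
    have "u = 0 \<or> (u, 0) \<in> parcs T \<and> (0, u) \<in> parcs T" using that by (auto simp: T_def)
    then show "u \<rightarrow>\<^sup>*\<^bsub>with_proj T\<^esub> 0" "0 \<rightarrow>\<^sup>*\<^bsub>with_proj T\<^esub> u"
      using reachable_refl[of 0] V assms reachable_adjI[of u 0] reachable_adjI[of 0 u] by force+
  qed
  have "u \<rightarrow>\<^sup>*\<^bsub>with_proj T\<^esub> v" if "u < n" "v < n" for u v
    using to0[OF that(1)] from0[OF that(2)] by (rule reachable_trans)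
  then have "strongly_connected (with_proj T)"
    unfolding strongly_connected_def with_proj_simps V using assms by force
  moreover have "mk_symmetric (with_proj T) = T"
    by (auto simp: mk_symmetric_def T_def)
  ultimately have conn: "Digraph_Component.connected (with_proj T)"
    by (simp add: connected_def)
  have "False" if c: "cycle p" and l: "length p \<ge> 3" for p
  proof -
    obtain e1 e2 e3 q where p: "p = e1 # e2 # e3 # q"
      using l by (auto simp: numeral_3_eq_3 Suc_le_length_iff)
    obtain u where w: "awalk u p u" and d: "distinct (tl (pawalk_verts u p))"
      using c by (auto simp: cycle_def)
    have arcs: "e1 \<in> parcs T" "e2 \<in> parcs T" "e3 \<in> parcs T"
      and ch: "fst e1 = u" "fst e2 = snd e1" "fst e3 = snd e2" "pcas (snd e3) q u"
      using w p by (auto simp: awalk_def)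
    have star: "(fst e = 0) \<noteq> (snd e = 0)" if "e \<in> parcs T" for e
      using that by (auto simp: T_def)
    have last: "u \<in> set (pawalk_verts (snd e3) q)"
      using ch(4) by (induct q arbitrary: e3) auto
    have first: "snd e3 \<in> set (pawalk_verts (snd e3) q)"
      using ch(4) by (cases q) auto
    show False
      using d p ch star[OF arcs(1)] star[OF arcs(2)] star[OF arcs(3)] last first
      by auto
  qed
  then show ?thesis
    using conn pg assms V unfolding labelled_tree_def labelled_graph_def by blast
qed

end

theory Submission
  imports Defs
begin

text \<open>
  Self-reachability is a statement about orders of the vertices. Suppose a nonempty legal sequence
  returns from \<open>s\<close> to \<open>s\<close> on a connected graph. Every vertex fires in it, for otherwise a silent
  vertex next to a firing one would end with more chips than it had. List the vertices by the time
  of their last firing. After its last firing a vertex holds a nonnegative number of chips, and each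
  neighbour that comes later in the list hands it one more; so in the end, that is in \<open>s\<close>, it has at
  least as many chips as it has later neighbours (\<open>covers_later_remdups\<close>). Conversely, if the
  vertices can be listed so that each has in \<open>s\<close> at least as many chips as later neighbours, firing
  them once each in this order is legal (\<open>covers_later_legal\<close>), because the earlier neighbours have
  supplied the missing chips, and it restores \<open>s\<close>. This gives \<open>self_reachable_iff_fireable\<close>.
  
  On a tree these configurations are counted by removing a leaf \<open>v\<close> with neighbour \<open>u\<close>
  (\<open>fireable_leaf\<close>). If \<open>v\<close> has a chip, it may as well be first in the list, and the condition on the
  rest is that of the smaller tree. If \<open>v\<close> has none, it must come after \<open>u\<close>, and this costs \<open>u\<close> exactly
  one chip. Hence, with \<open>C l n\<close> configurations of \<open>l\<close> chips on a tree with \<open>n\<close> vertices,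
  \<open>C l n = C (l - 1) (n - 1) + (\<Sum>j<l. C j (n - 1))\<close> for \<open>l \<ge> 1\<close>, and \<open>C 0 n = 0\<close>, if \<open>n \<ge> 2\<close>. The tree
  enters only through its number of vertices, and subtracting the formula for \<open>l - 1\<close> from the one
  for \<open>l\<close> gives the recurrence.
  
  For this induction a tree has to be built up by attaching leaves (\<open>labelled_tree_imp_tree_on\<close>). A
  maximal subtree so built is everything: an outside vertex next to it has only one neighbour in it,
  since two of them would close a cycle, and so it could be attached.
\<close>

section \<open>Trees grown by attaching leaves\<close>

inductive tree_on :: "'a set \<Rightarrow> ('a \<times> 'a) set \<Rightarrow> bool" where
  single: "tree_on {v} {}"
| leaf: "tree_on V E \<Longrightarrow> u \<in> V \<Longrightarrow> v \<notin> V \<Longrightarrow> tree_on (insert v V) (insert (u, v) (insert (v, u) E))"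

lemma tree_on_finite: "tree_on V E \<Longrightarrow> finite V"
  by (induction rule: tree_on.induct) auto

lemma tree_on_nonempty: "tree_on V E \<Longrightarrow> V \<noteq> {}"
  by (induction rule: tree_on.induct) auto

lemma tree_on_arcs: "tree_on V E \<Longrightarrow> E \<subseteq> V \<times> V"
  by (induction rule: tree_on.induct) auto

lemma pcas_snoc: "pcas x (p @ [(u, v)]) z \<longleftrightarrow> pcas x p u \<and> v = z"
  by (induction p arbitrary: x) auto

lemma pawalk_verts_snoc: "pcas x p u \<Longrightarrow> pawalk_verts x (p @ [(u, v)]) = pawalk_verts x p @ [v]"
  by (induction p arbitrary: x) auto

text \<open>
  The path is phrased with \<^const>\<open>pcas\<close> and \<^const>\<open>pawalk_verts\<close>, so that it can be read as a walk in
  any larger graph whose arcs include \<open>E\<close>.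
\<close>

lemma tree_on_path:
  assumes "tree_on V E" "x \<in> V" "y \<in> V"
  shows "\<exists>p. pcas x p y \<and> set p \<subseteq> E \<and> distinct (pawalk_verts x p) \<and> set (pawalk_verts x p) \<subseteq> V"
  using assms
proof (induction arbitrary: x y rule: tree_on.induct)
  case (single v)
  then show ?case by (intro exI[of _ "[]"]) auto
next
  case (leaf V E u v)
  consider "x = v" "y = v" | "x = v" "y \<in> V" | "x \<in> V" "y = v" | "x \<in> V" "y \<in> V"
    using leaf.prems by auto
  then show ?case
  proof cases
    case 1
    then show ?thesis by (intro exI[of _ "[]"]) auto
  next
    case 2
    obtain p where "pcas u p y" "set p \<subseteq> E" "distinct (pawalk_verts u p)" "set (pawalk_verts u p) \<subseteq> V"
      using leaf.IH[OF \<open>u \<in> V\<close> \<open>y \<in> V\<close>] by blast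
    then show ?thesis using 2 leaf.hyps by (intro exI[of _ "(v, u) # p"]) auto
  next
    case 3
    obtain p where "pcas x p u" "set p \<subseteq> E" "distinct (pawalk_verts x p)" "set (pawalk_verts x p) \<subseteq> V"
      using leaf.IH[OF \<open>x \<in> V\<close> \<open>u \<in> V\<close>] by blast
    then show ?thesis using 3 leaf.hyps
      by (intro exI[of _ "p @ [(u, v)]"]) (auto simp: pcas_snoc pawalk_verts_snoc)
  next
    case 4
    then obtain p where "pcas x p y" "set p \<subseteq> E" "distinct (pawalk_verts x p)" "set (pawalk_verts x p) \<subseteq> V"
      using leaf.IH by blast
    then show ?thesis by (intro exI[of _ p]) auto
  qed
qed

lemma parcs_sym:
  assumes "pair_graph G" "(x, y) \<in> parcs G"
  shows "(y, x) \<in> parcs G"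
proof -
  interpret pair_graph G by fact
  have "sym (parcs G)" using pair_sym_arcs by (simp add: symmetric_def)
  then show ?thesis using assms(2) by (rule symD)
qed

lemma parcs_irrefl:
  assumes "pair_graph G"
  shows "(x, x) \<notin> parcs G"
proof -
  interpret pair_graph G by fact
  show ?thesis using pair_no_loops[of "(x, x)"] by auto
qed

text \<open>
  This is the only form in which connectedness is used: to enlarge a subtree, and to find a silent
  vertex next to a firing one.
\<close>

lemma connected_crossing_arc:
  assumes "pair_graph G" "Digraph_Component.connected (with_proj G)"
    and "W \<subseteq> pverts G" "W \<noteq> {}" "W \<noteq> pverts G"
  obtains a b where "a \<in> W" "b \<in> pverts G - W" "(a, b) \<in> parcs G"
proof -
  interpret pair_graph G by fact
  obtain x y where xy: "x \<in> W" "y \<in> pverts G - W" using assms(3-5) by blast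
  have "x \<rightarrow>\<^sup>*\<^bsub>mk_symmetric (with_proj G)\<^esub> y"
    using assms(2,3) xy unfolding connected_def strongly_connected_def by auto
  then have "x \<rightarrow>\<^sup>*\<^bsub>with_proj G\<^esub> y"
    using reachable_mk_symmetric_eq[OF sym_arcs] by simp
  then have "y \<notin> W \<longrightarrow> (\<exists>a\<in>W. \<exists>b\<in>pverts G - W. (a, b) \<in> parcs G)"
  proof (induction rule: reachable_induct)
    case base
    then show ?case using xy by simp
  next
    case (step c d)
    then have "(c, d) \<in> parcs G" by simp
    moreover from this have "d \<in> pverts G" using arc_snd_in_verts by fastforce
    ultimately show ?case using step by blast
  qed
  then show thesis using xy that by blast
qed

text \<open>
  Take a largest vertex set \<open>W\<close> on which the graph induces a tree grown by leaves. If \<open>W\<close> is not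
  everything, an arc leaves it, from \<open>u\<close> to \<open>v\<close> say. A second neighbour \<open>w\<close> of \<open>v\<close> in \<open>W\<close> would give the
  cycle from \<open>v\<close> to \<open>u\<close>, through \<open>W\<close> to \<open>w\<close>, and back to \<open>v\<close>; so \<open>v\<close> is a leaf over \<open>W\<close>,
  contradicting the choice of \<open>W\<close>.
\<close>

lemma labelled_tree_imp_tree_on:
  assumes "labelled_tree n T"
  shows "tree_on {..<n} (parcs T)"
proof -
  have pg: "pair_graph T" and V: "pverts T = {..<n}" and n: "n \<ge> 1"
    and conn: "Digraph_Component.connected (with_proj T)"
    and acyc: "\<And>p. pre_digraph.cycle (with_proj T) p \<Longrightarrow> length p < 3"
    using assms unfolding labelled_tree_def labelled_graph_def by force+
  interpret pair_graph T by (rule pg)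
  have arcsV: "parcs T \<subseteq> {..<n} \<times> {..<n}"
    using arc_fst_in_verts arc_snd_in_verts V by fastforce
  have symE: "(x, y) \<in> parcs T \<Longrightarrow> (y, x) \<in> parcs T" for x y
    using parcs_sym[OF pg] .
  note irr = parcs_irrefl[OF pg]
  define E where "E W = parcs T \<inter> W \<times> W" for W
  define P where "P W \<longleftrightarrow> W \<subseteq> {..<n} \<and> tree_on W (E W)" for W
  have "E {0} = {}" using irr by (auto simp: E_def)
  then have P0: "P {0}" using n tree_on.single[of 0] by (simp add: P_def)
  have "\<forall>W. P W \<longrightarrow> card W \<le> n"
    using card_mono[of "{..<n}"] by (auto simp: P_def)
  then obtain W where "P W" and maxi: "\<And>W'. P W' \<Longrightarrow> card W' \<le> card W"
    using ex_has_greatest_nat[of P "{0}" card "Suc n"] P0 by (auto simp: less_Suc_eq_le)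
  then have W: "W \<subseteq> {..<n}" "tree_on W (E W)" by (simp_all add: P_def)
  have Wne: "W \<noteq> {}" using W tree_on_nonempty by blast
  have "W = {..<n}"
  proof (rule ccontr)
    assume "W \<noteq> {..<n}"
    then obtain u v where uv: "u \<in> W" "v \<in> {..<n} - W" "(u, v) \<in> parcs T"
      using connected_crossing_arc[OF pg conn, of W] W Wne V by auto
    have only: "w = u" if w: "w \<in> W" "(w, v) \<in> parcs T" for w
    proof (rule ccontr)
      assume "w \<noteq> u"
      obtain p where p: "pcas u p w" "set p \<subseteq> E W" "distinct (pawalk_verts u p)"
          "set (pawalk_verts u p) \<subseteq> W"
        using tree_on_path[OF W(2) uv(1) w(1)] by blast
      let ?c = "(v, u) # p @ [(w, v)]"
      have "pcas u (p @ [(w, v)]) v" using p(1) by (simp only: pcas_snoc)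
      moreover have "set ?c \<subseteq> parcs T" using p(2) w(2) symE[OF uv(3)] by (auto simp: E_def)
      ultimately have "awalk v ?c v" using uv(2) V by (simp add: awalk_def)
      moreover have "distinct (tl (pawalk_verts v ?c))"
        using p uv(2) by (auto simp: pawalk_verts_snoc)
      ultimately have "cycle ?c" unfolding cycle_def by blast
      \<comment> \<open>The two arcs at \<open>v\<close> and at least one arc of \<open>p\<close> make the cycle long enough.\<close>
      moreover have "p \<noteq> []" using p(1) \<open>w \<noteq> u\<close> by auto
      ultimately show False using acyc[of ?c] by (cases p) auto
    qed
    have only': "w = u" if "w \<in> W" "(v, w) \<in> parcs T" for w
      using only[OF that(1) symE[OF that(2)]] .
    have "E (insert v W) = insert (u, v) (insert (v, u) (E W))"
      using uv symE[OF uv(3)] irr[of v] by (auto simp: E_def dest: only only')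
    then have "P (insert v W)"
      using tree_on.leaf[OF W(2) uv(1)] W(1) uv(2) by (simp add: P_def)
    then have "card (insert v W) \<le> card W" by (rule maxi)
    then show False using uv(2) tree_on_finite[OF W(2)] by simp
  qed
  moreover have "E {..<n} = parcs T" using arcsV by (auto simp: E_def)
  ultimately show ?thesis using W by simp
qed

section \<open>Orders in which every vertex covers its later neighbours\<close>

fun covers_later :: "('a \<times> 'a) set \<Rightarrow> ('a \<Rightarrow> nat) \<Rightarrow> 'a list \<Rightarrow> bool" where
  "covers_later E s [] \<longleftrightarrow> True"
| "covers_later E s (v # vs) \<longleftrightarrow> card {w \<in> set vs. (v, w) \<in> E} \<le> s v \<and> covers_later E s vs"

text \<open>
  If the vertices are fired once each in the order \<open>vs\<close>, then a vertex has already received a chip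
  from each earlier neighbour when its turn comes. It can fire if its own chips make up for the
  later ones, which is what \<^const>\<open>covers_later\<close> requires.
\<close>

definition fireable :: "'a set \<Rightarrow> ('a \<times> 'a) set \<Rightarrow> ('a \<Rightarrow> nat) \<Rightarrow> bool" where
  "fireable V E s \<longleftrightarrow> (\<exists>vs. distinct vs \<and> set vs = V \<and> covers_later E s vs)"

lemma covers_later_mono:
  assumes "covers_later E s vs" "\<And>v w. v \<in> set vs \<Longrightarrow> (v, w) \<in> F \<Longrightarrow> w \<in> set vs \<Longrightarrow> (v, w) \<in> E"
    and "\<And>v. v \<in> set vs \<Longrightarrow> s v \<le> t v"
  shows "covers_later F t vs"
  using assms
proof (induction vs)
  case (Cons v vs)
  have "card {w \<in> set vs. (v, w) \<in> F} \<le> card {w \<in> set vs. (v, w) \<in> E}"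
    using Cons.prems(2) by (intro card_mono) auto
  also have "\<dots> \<le> s v" using Cons.prems(1) by simp
  also have "\<dots> \<le> t v" using Cons.prems(3) by simp
  finally show ?case using Cons by auto
qed simp

lemma fireable_cong:
  assumes "\<And>v. v \<in> V \<Longrightarrow> s v = t v"
  shows "fireable V E s \<longleftrightarrow> fireable V E t"
proof -
  have "covers_later E s vs \<longleftrightarrow> covers_later E t vs" if "set vs = V" for vs
    using covers_later_mono[of E s vs E t] covers_later_mono[of E t vs E s] assms that by auto
  then show ?thesis by (auto simp: fireable_def)
qed

lemma covers_later_remove1:
  "covers_later E s vs \<Longrightarrow> covers_later E s (remove1 x vs)"
proof (induction vs)
  case (Cons v vs)
  have "card {w \<in> set (remove1 x vs). (v, w) \<in> E} \<le> card {w \<in> set vs. (v, w) \<in> E}"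
    using set_remove1_subset[of x vs] by (intro card_mono) auto
  then show ?case using Cons by auto
qed simp

text \<open>
  A leaf that comes last needs no chips; only its neighbour has one more later neighbour to cover.
\<close>

lemma covers_later_snoc_leaf:
  assumes "covers_later E s vs" "distinct vs" "v \<notin> set vs" "E \<subseteq> V \<times> V" "v \<notin> V"
  shows "covers_later (insert (u, v) (insert (v, u) E)) (s(u := Suc (s u))) (vs @ [v])"
  using assms
proof (induction vs)
  case (Cons a vs)
  let ?F = "insert (u, v) (insert (v, u) E)"
  let ?A = "{w \<in> set vs. (a, w) \<in> E}"
  have "{w \<in> set (vs @ [v]). (a, w) \<in> ?F} = (if a = u then insert v ?A else ?A)"
    using Cons.prems by auto
  moreover have "card (insert v ?A) \<le> Suc (card ?A)" by (simp add: card_insert_if)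
  moreover have "card ?A \<le> s a" using Cons.prems by simp
  ultimately have "card {w \<in> set (vs @ [v]). (a, w) \<in> ?F} \<le> (s(u := Suc (s u))) a" by auto
  then show ?case using Cons by auto
qed simp

text \<open>
  A leaf without chips cannot have its neighbour \<open>u\<close> after it. So \<open>u\<close> precedes it and one of its
  chips is spent on the leaf; that chip is no longer needed once the leaf is gone.
\<close>

lemma covers_later_remove_last_leaf:
  assumes "covers_later (insert (u, v) (insert (v, u) E)) s vs" "distinct vs" "v \<in> set vs"
    "E \<subseteq> V \<times> V" "v \<notin> V" "u \<in> set vs" "u \<in> V" "s v = 0"
  shows "0 < s u \<and> covers_later E (s(u := s u - 1)) (remove1 v vs)"
  using assms
proof (induction vs)
  case (Cons a vs)
  let ?F = "insert (u, v) (insert (v, u) E)"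
  have uv: "u \<noteq> v" using Cons.prems by auto
  have hd: "card {w \<in> set vs. (a, w) \<in> ?F} \<le> s a" and tl: "covers_later ?F s vs"
    using Cons.prems by auto
  have "a \<noteq> v"
  proof
    assume "a = v"
    then have "u \<in> {w \<in> set vs. (a, w) \<in> ?F}" using Cons.prems uv by auto
    then have "0 < card {w \<in> set vs. (a, w) \<in> ?F}" by (subst card_gt_0_iff) auto
    then show False using hd \<open>s v = 0\<close> unfolding \<open>a = v\<close> by linarith
  qed
  then have v: "v \<in> set vs" using Cons.prems by auto
  have dv: "distinct vs" "a \<notin> set vs" using Cons.prems by auto
  show ?case
  proof (cases "a = u")
    case True
    let ?A = "{w \<in> set (remove1 v vs). (u, w) \<in> E}"
    have "insert v ?A \<subseteq> {w \<in> set vs. (a, w) \<in> ?F}"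
      using True v dv by auto
    then have "card (insert v ?A) \<le> s u"
      using hd True card_mono[of "{w \<in> set vs. (a, w) \<in> ?F}" "insert v ?A"] by fastforce
    moreover have "v \<notin> ?A" using dv by simp
    ultimately have "Suc (card ?A) \<le> s u" by simp
    moreover have "covers_later E (s(u := s u - 1)) (remove1 v vs)"
      using covers_later_remove1[OF tl, of v]
      by (rule covers_later_mono) (use True dv notin_set_remove1[of u vs] in auto)
    ultimately show ?thesis using True \<open>a \<noteq> v\<close> by (auto simp del: fun_upd_apply simp: fun_upd_same)
  next
    case False
    then have us: "u \<in> set vs" using Cons.prems(6) by simp
    have IH: "0 < s u" "covers_later E (s(u := s u - 1)) (remove1 v vs)"
      using Cons.IH[OF tl dv(1) v Cons.prems(4,5) _ Cons.prems(7,8)] us by blast+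
    have "card {w \<in> set (remove1 v vs). (a, w) \<in> E} \<le> card {w \<in> set vs. (a, w) \<in> ?F}"
      using set_remove1_subset[of v vs] by (intro card_mono) auto
    then have "card {w \<in> set (remove1 v vs). (a, w) \<in> E} \<le> (s(u := s u - 1)) a"
      using hd False by simp
    then show ?thesis using IH \<open>a \<noteq> v\<close> by (simp del: fun_upd_apply)
  qed
qed simp

text \<open>
  The place of the leaf in the order is dictated by whether it has a chip: first if it has one,
  last if it has none.
\<close>

lemma fireable_leaf:
  assumes E: "E \<subseteq> V \<times> V" and u: "u \<in> V" and v: "v \<notin> V"
  shows "fireable (insert v V) (insert (u, v) (insert (v, u) E)) s \<longleftrightarrow>
    (if s v = 0 then 0 < s u \<and> fireable V E (s(u := s u - 1)) else fireable V E s)"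
    (is "fireable ?W ?F s \<longleftrightarrow> ?R")
proof
  assume "fireable ?W ?F s"
  then obtain vs where vs: "distinct vs" "set vs = ?W" "covers_later ?F s vs"
    by (auto simp: fireable_def)
  have rem: "distinct (remove1 v vs)" "set (remove1 v vs) = V" using vs v by auto
  show ?R
  proof (cases "s v = 0")
    case True
    then show ?thesis
      using covers_later_remove_last_leaf[OF vs(3) vs(1) _ E v] rem vs(2) u
      unfolding fireable_def by auto
  next
    case False
    have "covers_later E s (remove1 v vs)"
      using covers_later_remove1[OF vs(3)] by (rule covers_later_mono) auto
    then show ?thesis using False rem unfolding fireable_def by auto
  qed
next
  assume R: ?R
  show "fireable ?W ?F s"
  proof (cases "s v = 0")
    case True
    then obtain vs where vs: "distinct vs" "set vs = V" "covers_later E (s(u := s u - 1)) vs"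
      and su: "0 < s u"
      using R by (auto simp: fireable_def)
    have "(s(u := s u - 1))(u := Suc ((s(u := s u - 1)) u)) = s" using su by auto
    then have "covers_later ?F s (vs @ [v])"
      using covers_later_snoc_leaf[OF vs(3,1) _ E v, of u] vs(2) v by simp
    then show ?thesis using vs v unfolding fireable_def
      by (intro exI[of _ "vs @ [v]"]) auto
  next
    case False
    then obtain vs where vs: "distinct vs" "set vs = V" "covers_later E s vs"
      using R by (auto simp: fireable_def)
    have "covers_later ?F s vs"
      using vs(3) by (rule covers_later_mono) (use vs v in auto)
    moreover have "{w \<in> set vs. (v, w) \<in> ?F} = {u}" using vs u v E by auto
    ultimately have "covers_later ?F s (v # vs)" using False by auto
    then show ?thesis using vs v unfolding fireable_def
      by (intro exI[of _ "v # vs"]) auto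
  qed
qed

section \<open>Counting on a tree\<close>

text \<open>
  The number of configurations with \<open>l\<close> chips on a tree with \<open>Suc m\<close> vertices is \<open>config_count m l\<close>.
  Shifting the number of vertices by one lets the recursion on leaves be primitive.
\<close>

primrec config_count :: "nat \<Rightarrow> nat \<Rightarrow> nat" where
  "config_count 0 l = 1"
| "config_count (Suc m) l = (if l = 0 then 0 else config_count m (l - 1)) + (\<Sum>j<l. config_count m j)"

text \<open>
  Configurations are functions that vanish off \<open>V\<close>: this makes a configuration on a subtree one on
  the larger tree as well, and lets finite sets of them be counted.
\<close>

definition fireable_configs :: "'a set \<Rightarrow> ('a \<times> 'a) set \<Rightarrow> nat \<Rightarrow> ('a \<Rightarrow> nat) set" where
  "fireable_configs V E l = {s. (\<forall>x. x \<notin> V \<longrightarrow> s x = 0) \<and> sum s V = l \<and> fireable V E s}"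

text \<open>
  The first part collects the configurations with no chip on the leaf \<open>v\<close>, which come from a
  configuration on the smaller tree by giving \<open>u\<close> one more chip; the second part those in which \<open>v\<close>
  has \<open>l - j > 0\<close> chips.
\<close>

lemma fireable_configs_leaf:
  assumes fin: "finite V" and E: "E \<subseteq> V \<times> V" and u: "u \<in> V" and v: "v \<notin> V"
  shows "fireable_configs (insert v V) (insert (u, v) (insert (v, u) E)) l =
    (if l = 0 then {} else (\<lambda>s. s(u := Suc (s u))) ` fireable_configs V E (l - 1)) \<union>
    (\<Union>j<l. (\<lambda>s. s(v := l - j)) ` fireable_configs V E j)" (is "?L = ?A \<union> ?B")
proof (intro equalityI subsetI)
  fix s assume s: "s \<in> ?L"
  then have supp: "\<And>x. x \<notin> V \<Longrightarrow> x \<noteq> v \<Longrightarrow> s x = 0" and tot: "s v + sum s V = l"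
    using fin v by (auto simp: fireable_configs_def)
  have fa: "if s v = 0 then 0 < s u \<and> fireable V E (s(u := s u - 1)) else fireable V E s"
    using s fireable_leaf[OF E u v, of s] unfolding fireable_configs_def by blast
  show "s \<in> ?A \<union> ?B"
  proof (cases "s v = 0")
    case True
    let ?t = "s(u := s u - 1)"
    have su: "0 < s u" "fireable V E ?t" using fa True by auto
    have "sum s V = s u + sum s (V - {u})" using fin u by (rule sum.remove)
    moreover have "sum ?t V = ?t u + sum ?t (V - {u})" using fin u by (rule sum.remove)
    moreover have "sum ?t (V - {u}) = sum s (V - {u})" by (intro sum.cong) auto
    ultimately have "sum ?t V = l - 1" "l \<noteq> 0" using su tot True by auto
    moreover have "?t x = 0" if "x \<notin> V" for x using that supp[of x] True u by auto
    ultimately have t: "?t \<in> fireable_configs V E (l - 1)"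
      using su by (simp add: fireable_configs_def)
    have "s = (\<lambda>s. s(u := Suc (s u))) ?t" using su by auto
    then have "s \<in> (\<lambda>s. s(u := Suc (s u))) ` fireable_configs V E (l - 1)"
      using t by (rule image_eqI)
    then show ?thesis using \<open>l \<noteq> 0\<close> by simp
  next
    case False
    let ?t = "s(v := 0)"
    have sum: "sum ?t V = sum s V" using v by (intro sum.cong) auto
    have "fireable V E ?t"
      using fa False v fireable_cong[of V ?t s E] by (metis fun_upd_other)
    then have "?t \<in> fireable_configs V E (sum s V)"
      using supp sum by (auto simp: fireable_configs_def)
    moreover have "s = ?t(v := l - sum s V)" using tot by auto
    moreover have "sum s V < l" using tot False by simp
    ultimately show ?thesis by blast
  qed
next
  fix s assume "s \<in> ?A \<union> ?B"
  then show "s \<in> ?L"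
  proof
    assume "s \<in> ?A"
    then obtain t where l: "l \<noteq> 0" and t: "t \<in> fireable_configs V E (l - 1)" and s: "s = t(u := Suc (t u))"
      by (auto split: if_splits)
    have "sum t V = t u + sum t (V - {u})" using fin u by (rule sum.remove)
    moreover have "sum s V = s u + sum s (V - {u})" using fin u by (rule sum.remove)
    moreover have "sum s (V - {u}) = sum t (V - {u})" using s by (intro sum.cong) auto
    ultimately have "sum s V = l" using t l s by (auto simp: fireable_configs_def)
    moreover have "s v = 0" using t s u v by (auto simp: fireable_configs_def)
    moreover have "s(u := s u - 1) = t" "0 < s u" using s by auto
    ultimately show ?thesis using fireable_leaf[OF E u v, of s] t s fin v u
      by (auto simp: fireable_configs_def)
  next
    assume "s \<in> ?B"
    then obtain j t where j: "j < l" and t: "t \<in> fireable_configs V E j" and s: "s = t(v := l - j)"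
      by auto
    have "sum s V = sum t V" using s v by (intro sum.cong) auto
    moreover have "fireable V E s"
      using t v s fireable_cong[of V s t E] unfolding fireable_configs_def
      by (metis (mono_tags, lifting) fun_upd_other mem_Collect_eq)
    ultimately show ?thesis using fireable_leaf[OF E u v, of s] t s fin v j
      by (auto simp: fireable_configs_def)
  qed
qed

text \<open>
  The images of the preceding lemma are disjoint, as they prescribe different numbers of chips on
  the leaf. Finiteness is carried through the same induction because the cardinality of a disjoint
  union depends on it.
\<close>

lemma card_fireable_configs:
  assumes "tree_on V E"
  shows "finite (fireable_configs V E l) \<and> card (fireable_configs V E l) = config_count (card V - 1) l"
  using assms
proof (induction arbitrary: l rule: tree_on.induct)
  case (single v)
  have "fireable {v} {} s" for s :: "'a \<Rightarrow> nat"
    unfolding fireable_def by (intro exI[of _ "[v]"]) simp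
  then have "fireable_configs {v} {} l = {(\<lambda>x. 0)(v := l)}"
    by (auto simp: fireable_configs_def)
  then show ?case by simp
next
  case (leaf V E u v)
  have fin: "finite V" and E: "E \<subseteq> V \<times> V" using leaf.hyps(1) tree_on_finite tree_on_arcs by blast+
  let ?S = "\<lambda>j. fireable_configs V E j"
  let ?A = "if l = 0 then {} else (\<lambda>s. s(u := Suc (s u))) ` ?S (l - 1)"
  let ?B = "\<lambda>j. (\<lambda>s. s(v := l - j)) ` ?S j"
  have v0: "s v = 0" if "s \<in> ?S j" for s j
    using that leaf.hyps by (simp add: fireable_configs_def)
  have uv: "u \<noteq> v" using leaf.hyps by auto
  have eq: "fireable_configs (insert v V) (insert (u, v) (insert (v, u) E)) l = ?A \<union> (\<Union>j<l. ?B j)"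
    using fireable_configs_leaf[OF fin E leaf.hyps(2,3)] .
  have finA: "finite ?A" and finB: "finite (?B j)" for j using leaf.IH by auto
  have "inj (\<lambda>s :: 'a \<Rightarrow> nat. s(u := Suc (s u)))"
    by (rule injI) (metis fun_upd_same fun_upd_triv fun_upd_upd nat.inject)
  then have cA: "card ?A = (if l = 0 then 0 else config_count (card V - 1) (l - 1))"
    using leaf.IH[of "l - 1"] by (simp add: card_image[OF inj_on_subset])
  have cB: "card (?B j) = config_count (card V - 1) j" for j
  proof -
    have "inj_on (\<lambda>s. s(v := l - j)) (?S j)"
      by (rule inj_onI) (metis v0 fun_upd_triv fun_upd_upd)
    then show ?thesis using leaf.IH by (simp add: card_image)
  qed
  have "?B i \<inter> ?B j = {}" if "i < l" "j < l" "i \<noteq> j" for i j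
  proof -
    have "s v = l - i" if "s \<in> ?B i" for s using that by auto
    moreover have "s v = l - j" if "s \<in> ?B j" for s using that by auto
    ultimately show ?thesis using that by fastforce
  qed
  then have "card (\<Union>j<l. ?B j) = (\<Sum>j<l. config_count (card V - 1) j)"
    using finB cB by (subst card_UN_disjoint) auto
  moreover have "?A \<inter> (\<Union>j<l. ?B j) = {}"
  proof -
    have "s v = 0" if "s \<in> ?A" for s using that uv v0 by (auto split: if_splits)
    moreover have "s v > 0" if "s \<in> (\<Union>j<l. ?B j)" for s using that by auto
    ultimately show ?thesis by fastforce
  qed
  ultimately have card: "card (?A \<union> (\<Union>j<l. ?B j)) = config_count (Suc (card V - 1)) l"
    using finA finB cA by (subst card_Un_disjoint) auto
  have "card V > 0" using fin leaf.hyps by (auto simp: card_gt_0_iff)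
  then have "card (insert v V) - 1 = Suc (card V - 1)" using fin leaf.hyps by simp
  then show ?case unfolding eq using card finA finB by simp
qed


section \<open>Firing sequences and orders\<close>

text \<open>
  The change at \<open>w\<close> caused by firing \<open>i\<close>, that is minus the entry \<open>(w, i)\<close> of the Laplacian. Since it
  does not depend on the configuration, the effect of a firing sequence is a sum.
\<close>

definition gain :: "nat pair_pre_digraph \<Rightarrow> nat \<Rightarrow> nat \<Rightarrow> int" where
  "gain G w i = (if i = w then - int (deg G w) else if (w, i) \<in> parcs G then 1 else 0)"

lemma fire_index:
  assumes "pverts G = {..<n}" "c \<in> carrier_vec n" "i < n" "w < n"
  shows "fire G i c $ w = c $ w + gain G w i"
proof -
  have "(laplacian G *\<^sub>v unit_vec n i) $ w = laplacian G $$ (w, i)"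
    using assms by (simp add: laplacian_def scalar_prod_right_unit)
  then show ?thesis
    using assms by (simp add: fire_def laplacian_def gain_def)
qed

lemma fire_carrier:
  assumes "pverts G = {..<n}" "c \<in> carrier_vec n"
  shows "fire G i c \<in> carrier_vec n"
  by (rule carrier_vecI) (use assms in \<open>simp add: fire_def laplacian_def\<close>)

lemma fold_fire_carrier:
  assumes "pverts G = {..<n}" "c \<in> carrier_vec n"
  shows "fold (fire G) is c \<in> carrier_vec n"
  using assms by (induction "is" arbitrary: c) (auto intro: fire_carrier)

lemma fold_fire_index:
  assumes "pverts G = {..<n}" "c \<in> carrier_vec n" "set is \<subseteq> {..<n}" "w < n"
  shows "fold (fire G) is c $ w = c $ w + (\<Sum>i\<leftarrow>is. gain G w i)"
  using assms(2,3)
proof (induction "is" arbitrary: c)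
  case (Cons i "is")
  then show ?case
    using fire_index[OF assms(1) Cons.prems(1), of i w] fire_carrier[OF assms(1)] assms(4) by auto
qed simp

lemma legal_firing_seq_verts: "legal_firing_seq G c is \<Longrightarrow> set is \<subseteq> pverts G"
  by (induction "is" arbitrary: c) auto

text \<open>
  A vertex that stays silent only receives chips, at least one from each neighbour that fires.
\<close>

lemma card_neighbours_le_gain:
  assumes "w \<notin> set is"
  shows "int (card {i \<in> set is. (w, i) \<in> parcs G}) \<le> (\<Sum>i\<leftarrow>is. gain G w i)"
  using assms
proof (induction "is")
  case (Cons i "is")
  let ?A = "{x \<in> set is. (w, x) \<in> parcs G}"
  have "{x \<in> set (i # is). (w, x) \<in> parcs G} = (if (w, i) \<in> parcs G then insert i ?A else ?A)"
    by auto
  moreover have "card (insert i ?A) \<le> Suc (card ?A)" by (simp add: card_insert_if)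
  ultimately show ?case using Cons by (auto simp: gain_def)
qed simp

text \<open>
  \<^const>\<open>remdups\<close> keeps the last occurrence of each entry, so \<open>remdups is\<close> lists the vertices by their
  last firing. Since the configurations before the end are nonnegative, the chips that a vertex
  receives after its last firing are still there at the end.
\<close>

lemma covers_later_remdups:
  assumes V: "pverts G = {..<n}" and c: "c \<in> carrier_vec n" "\<And>i. i < n \<Longrightarrow> 0 \<le> c $ i"
    and legal: "legal_firing_seq G c is"
  shows "covers_later (parcs G) (\<lambda>i. nat (fold (fire G) is c $ i)) (remdups is)"
  using c legal
proof (induction "is" arbitrary: c)
  case (Cons i "is")
  have i: "i < n" "int (deg G i) \<le> c $ i" "legal_firing_seq G (fire G i c) is"
    using Cons.prems V by auto
  have fc: "fire G i c \<in> carrier_vec n" using fire_carrier[OF V Cons.prems(1)] .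
  have nn: "0 \<le> fire G i c $ w" if "w < n" for w
    using fire_index[OF V Cons.prems(1) i(1) that] Cons.prems(2)[OF that] i(2)
    by (auto simp: gain_def)
  have IH: "covers_later (parcs G) (\<lambda>w. nat (fold (fire G) is (fire G i c) $ w)) (remdups is)"
    using Cons.IH[OF fc nn i(3)] .
  show ?case
  proof (cases "i \<in> set is")
    case True
    then show ?thesis using IH by simp
  next
    case False
    have "set is \<subseteq> {..<n}" using legal_firing_seq_verts[OF i(3)] V by simp
    then have "fold (fire G) is (fire G i c) $ i = fire G i c $ i + (\<Sum>j\<leftarrow>is. gain G i j)"
      using fold_fire_index[OF V fc _ i(1)] by blast
    then have "int (card {j \<in> set is. (i, j) \<in> parcs G}) \<le> fold (fire G) is (fire G i c) $ i"
      using card_neighbours_le_gain[OF False, of G] nn[OF i(1)] by linarith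
    then show ?thesis using IH False by simp
  qed
qed simp

text \<open>
  A silent vertex next to a firing one gains chips and never loses any, so the configuration could
  not recur.
\<close>

lemma returning_seq_fires_all:
  assumes pg: "pair_graph G" and conn: "Digraph_Component.connected (with_proj G)"
    and V: "pverts G = {..<n}" and c: "c \<in> carrier_vec n"
    and sub: "set is \<subseteq> {..<n}" and ne: "is \<noteq> []" and ret: "fold (fire G) is c = c"
  shows "set is = {..<n}"
proof (rule ccontr)
  assume "set is \<noteq> {..<n}"
  then obtain a b where ab: "a \<in> set is" "b \<in> {..<n} - set is" "(a, b) \<in> parcs G"
    using connected_crossing_arc[OF pg conn, of "set is"] sub ne V by auto
  then have "(b, a) \<in> parcs G" using parcs_sym[OF pg] by blast
  then have "a \<in> {i \<in> set is. (b, i) \<in> parcs G}" using ab by simp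
  then have "0 < card {i \<in> set is. (b, i) \<in> parcs G}" by (subst card_gt_0_iff) auto
  moreover have "int (card {i \<in> set is. (b, i) \<in> parcs G}) \<le> (\<Sum>i\<leftarrow>is. gain G b i)"
    using card_neighbours_le_gain ab by fastforce
  moreover have "c $ b = c $ b + (\<Sum>i\<leftarrow>is. gain G b i)"
    using fold_fire_index[OF V c sub, of b] ab ret by simp
  ultimately show False by linarith
qed

lemma deg_eq_card_neighbours:
  assumes "pair_graph G"
  shows "deg G v = card {w \<in> pverts G. (v, w) \<in> parcs G}"
proof -
  interpret pair_graph G by fact
  have "out_arcs (with_proj G) v = Pair v ` {w \<in> pverts G. (v, w) \<in> parcs G}"
    using arc_snd_in_verts by (fastforce simp: out_arcs_def)
  then show ?thesis by (simp add: out_degree_def card_image inj_on_def)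
qed

text \<open>
  For the induction, \<open>vs\<close> is what remains of the order and \<open>c\<close> the configuration reached: a waiting
  vertex has its chips from \<open>s\<close> and one from each neighbour that has fired. When its turn comes, the
  neighbours that have fired and the remaining ones together account for its degree.
\<close>

lemma covers_later_legal:
  assumes pg: "pair_graph G" and V: "pverts G = {..<n}"
    and "covers_later (parcs G) s vs" "distinct vs" "set vs \<subseteq> {..<n}" "c \<in> carrier_vec n"
    and "\<And>w. w \<in> set vs \<Longrightarrow> c $ w = int (s w + card {x \<in> {..<n} - set vs. (w, x) \<in> parcs G})"
  shows "legal_firing_seq G c vs"
  using assms(3-7)
proof (induction vs arbitrary: c)
  case (Cons v vs)
  interpret pair_graph G by (rule pg)
  note irr = parcs_irrefl[OF pg]
  have v: "v < n" "v \<notin> set vs" "card {w \<in> set vs. (v, w) \<in> parcs G} \<le> s v"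
    using Cons.prems by auto
  let ?before = "{x \<in> {..<n} - set (v # vs). (v, x) \<in> parcs G}"
  have "{w \<in> pverts G. (v, w) \<in> parcs G} = {w \<in> set vs. (v, w) \<in> parcs G} \<union> ?before"
    using V Cons.prems(3) irr by auto
  then have "deg G v = card ({w \<in> set vs. (v, w) \<in> parcs G} \<union> ?before)"
    by (simp only: deg_eq_card_neighbours[OF pg])
  also have "\<dots> \<le> card {w \<in> set vs. (v, w) \<in> parcs G} + card ?before"
    by (rule card_Un_le)
  finally have "int (deg G v) \<le> c $ v" using Cons.prems(5)[of v] v by simp
  moreover have "legal_firing_seq G (fire G v c) vs"
  proof (rule Cons.IH)
    show "fire G v c \<in> carrier_vec n" using fire_carrier[OF V Cons.prems(4)] .
    fix w assume w: "w \<in> set vs"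
    let ?A = "{x \<in> {..<n} - set (v # vs). (w, x) \<in> parcs G}"
    have "{x \<in> {..<n} - set vs. (w, x) \<in> parcs G} = (if (w, v) \<in> parcs G then insert v ?A else ?A)"
      using v by auto
    moreover have "card (insert v ?A) = Suc (card ?A)" by (subst card_insert_disjoint) auto
    moreover have "fire G v c $ w = c $ w + gain G w v"
      using fire_index[OF V Cons.prems(4) v(1)] w Cons.prems(3) by auto
    ultimately show "fire G v c $ w = int (s w + card {x \<in> {..<n} - set vs. (w, x) \<in> parcs G})"
      using Cons.prems(5)[of w] w v(2) by (auto simp: gain_def)
  qed (use Cons.prems in auto)
  ultimately show ?case using v V by simp
qed simp

text \<open>
  Firing every vertex once changes nothing: each vertex gives and receives as many chips as it has
  neighbours.
\<close>

lemma sum_gain_eq_0: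
  assumes pg: "pair_graph G" and w: "w \<in> pverts G"
  shows "(\<Sum>i\<in>pverts G. gain G w i) = 0"
proof -
  interpret pair_graph G by (rule pg)
  note irr = parcs_irrefl[OF pg]
  have "(\<Sum>i\<in>pverts G. gain G w i) = gain G w w + (\<Sum>i\<in>pverts G - {w}. gain G w i)"
    using w by (simp add: sum.remove)
  also have "(\<Sum>i\<in>pverts G - {w}. gain G w i) = (\<Sum>i\<in>pverts G - {w}. if (w, i) \<in> parcs G then 1 else 0)"
    by (intro sum.cong) (auto simp: gain_def)
  also have "\<dots> = int (card ((pverts G - {w}) \<inter> {i. (w, i) \<in> parcs G}))"
    by (simp add: sum.If_cases)
  also have "(pverts G - {w}) \<inter> {i. (w, i) \<in> parcs G} = {i \<in> pverts G. (w, i) \<in> parcs G}"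
    using irr by auto
  finally show ?thesis by (simp add: gain_def deg_eq_card_neighbours[OF pg])
qed

text \<open>
  This turns a condition on firing sequences of any length into one on a single order of the
  vertices.
\<close>

lemma self_reachable_iff_fireable:
  assumes pg: "pair_graph G" and conn: "Digraph_Component.connected (with_proj G)"
    and V: "pverts G = {..<n}" and n: "n \<ge> 1" and s: "s \<in> chip_configs G"
  shows "self_reachable G s \<longleftrightarrow> fireable {..<n} (parcs G) (\<lambda>i. nat (s $ i))"
proof
  have c: "s \<in> carrier_vec n" and nn: "\<And>i. i < n \<Longrightarrow> 0 \<le> s $ i"
    using s V by (auto simp: chip_configs_def)
  {
    assume "self_reachable G s"
    then obtain "is" where iseq: "is \<noteq> []" "legal_firing_seq G s is" "fold (fire G) is s = s"
      unfolding self_reachable_def reachable_configs_def by auto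
    then have "set is = {..<n}"
      using returning_seq_fires_all[OF pg conn V c] legal_firing_seq_verts[of G s "is"] V by simp
    moreover have "covers_later (parcs G) (\<lambda>i. nat (s $ i)) (remdups is)"
      using covers_later_remdups[OF V c nn iseq(2)] iseq(3) by simp
    ultimately show "fireable {..<n} (parcs G) (\<lambda>i. nat (s $ i))"
      unfolding fireable_def by (intro exI[of _ "remdups is"]) auto
  }
  assume "fireable {..<n} (parcs G) (\<lambda>i. nat (s $ i))"
  then obtain vs where vs: "distinct vs" "set vs = {..<n}"
    "covers_later (parcs G) (\<lambda>i. nat (s $ i)) vs"
    by (auto simp: fireable_def)
  have "legal_firing_seq G s vs"
    using covers_later_legal[OF pg V vs(3,1) _ c] vs(2) nn by auto
  moreover have "fold (fire G) vs s = s"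
  proof (rule eq_vecI)
    have fc: "fold (fire G) vs s \<in> carrier_vec n" using fold_fire_carrier[OF V c] .
    then show "dim_vec (fold (fire G) vs s) = dim_vec s" using c by simp
    fix w assume "w < dim_vec s"
    then have w: "w < n" using c by simp
    have "(\<Sum>i\<leftarrow>vs. gain G w i) = (\<Sum>i\<in>pverts G. gain G w i)"
      using vs(1,2) V by (simp only: sum_list_distinct_conv_sum_set)
    also have "\<dots> = 0" using sum_gain_eq_0[OF pg] V w by simp
    finally show "fold (fire G) vs s $ w = s $ w"
      using fold_fire_index[OF V c equalityD1[OF vs(2)] w] by (simp only: add_0_right)
  qed
  moreover have "vs \<noteq> []"
  proof -
    have "0 \<in> set vs" unfolding vs(2) using n by simp
    then show ?thesis by auto
  qed
  ultimately show "self_reachable G s"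
    unfolding self_reachable_def reachable_configs_def using s by force
qed

section \<open>The number of self-reachable configurations\<close>

text \<open>
  Natural-valued functions vanishing outside the vertex set correspond to nonnegative integer
  vectors.
\<close>

lemma card_self_reachable_configs:
  assumes T: "labelled_tree n T"
  shows "card (self_reachable_configs T l) = config_count (n - 1) l"
proof -
  have pg: "pair_graph T" and V: "pverts T = {..<n}" and n: "n \<ge> 1"
    and conn: "Digraph_Component.connected (with_proj T)"
    using T unfolding labelled_tree_def labelled_graph_def by auto
  let ?vec = "\<lambda>f. vec n (\<lambda>i. int (f i))"
  have chip: "s \<in> chip_configs T \<longleftrightarrow> (\<exists>f. (\<forall>x. x \<notin> {..<n} \<longrightarrow> f x = 0) \<and> s = ?vec f)" for s
  proof
    assume s: "s \<in> chip_configs T"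
    then have "s = ?vec (\<lambda>i. if i < n then nat (s $ i) else 0)"
      using V by (intro eq_vecI) (auto simp: chip_configs_def)
    then show "\<exists>f. (\<forall>x. x \<notin> {..<n} \<longrightarrow> f x = 0) \<and> s = ?vec f"
      by (intro exI[of _ "\<lambda>i. if i < n then nat (s $ i) else 0"]) simp
  qed (use V in \<open>auto simp: chip_configs_def\<close>)
  have sr: "self_reachable T (?vec f) \<longleftrightarrow> fireable {..<n} (parcs T) f" for f
  proof -
    have "?vec f \<in> chip_configs T" using V by (auto simp: chip_configs_def)
    moreover have "fireable {..<n} (parcs T) (\<lambda>i. nat (?vec f $ i)) \<longleftrightarrow> fireable {..<n} (parcs T) f"
      by (rule fireable_cong) simp
    ultimately show ?thesis using self_reachable_iff_fireable[OF pg conn V n] by simp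
  qed
  have num: "num_chips (?vec f) = int l \<longleftrightarrow> sum f {..<n} = l" for f
    by (simp add: num_chips_def flip: of_nat_sum)
  have "self_reachable_configs T l = ?vec ` fireable_configs {..<n} (parcs T) l"
  proof (intro equalityI subsetI)
    fix s assume "s \<in> self_reachable_configs T l"
    then have s: "self_reachable T s" "num_chips s = int l" "s \<in> chip_configs T"
      by (auto simp: self_reachable_configs_def self_reachable_def)
    then obtain f where "\<forall>x. x \<notin> {..<n} \<longrightarrow> f x = 0" "s = ?vec f" using chip by blast
    then show "s \<in> ?vec ` fireable_configs {..<n} (parcs T) l"
      using s sr num by (auto simp: fireable_configs_def)
  qed (use sr num in \<open>auto simp: fireable_configs_def self_reachable_configs_def\<close>)
  moreover have "inj_on ?vec (fireable_configs {..<n} (parcs T) l)"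
  proof (intro inj_onI ext)
    fix f g x
    assume fg: "f \<in> fireable_configs {..<n} (parcs T) l" "g \<in> fireable_configs {..<n} (parcs T) l"
      and eq: "?vec f = ?vec g"
    show "f x = g x"
    proof (cases "x < n")
      case True
      then show ?thesis using arg_cong[OF eq, of "\<lambda>v. v $ x"] by simp
    qed (use fg in \<open>simp add: fireable_configs_def\<close>)
  qed
  ultimately show ?thesis
    using card_fireable_configs[OF labelled_tree_imp_tree_on[OF T], of l] by (simp add: card_image)
qed

theorem theorem5p1:
  shows "\<exists>C :: nat \<Rightarrow> nat \<Rightarrow> nat.
     (\<forall>l n T. n \<ge> 1 \<longrightarrow> labelled_tree n T \<longrightarrow> card (self_reachable_configs T l) = C l n) \<and>
     (\<forall>l n. l \<ge> 2 \<longrightarrow> n \<ge> 2 \<longrightarrow>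
        int (C l n) = int (C (l - 1) n) + 2 * int (C (l - 1) (n - 1)) - int (C (l - 2) (n - 1))) \<and>
     (\<forall>l. C l 1 = 1) \<and>
     (\<forall>n \<ge> 2. C 0 n = 0) \<and>
     C 1 2 = 2 \<and>
     (\<forall>n \<ge> 3. C 1 n = 0)"
proof (intro exI[of _ "\<lambda>l n. config_count (n - 1) l"] conjI allI impI)
  fix l n :: nat assume "l \<ge> 2" "n \<ge> 2"
  then obtain k m where k: "l = Suc (Suc k)" and m: "n = Suc (Suc m)"
    by (metis Suc_le_D numeral_2_eq_2 Suc_le_mono)
  show "int (config_count (n - 1) l) = int (config_count (n - 1) (l - 1))
      + 2 * int (config_count (n - 1 - 1) (l - 1)) - int (config_count (n - 1 - 1) (l - 2))"
    by (simp add: k m)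
next
  fix n :: nat assume "n \<ge> 2"
  then obtain m where "n = Suc (Suc m)" by (metis Suc_le_D numeral_2_eq_2 Suc_le_mono)
  then show "config_count (n - 1) 0 = 0" by simp
next
  show "config_count (2 - 1) 1 = 2" by (simp add: numeral_2_eq_2)
next
  fix n :: nat assume "n \<ge> 3"
  then obtain m where "n = Suc (Suc (Suc m))" by (metis Suc_le_D numeral_3_eq_3 Suc_le_mono)
  then show "config_count (n - 1) 1 = 0" by simp
qed (simp_all add: card_self_reachable_configs)

end
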